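(* Let $\zeta$ be an aperiodic primitive constant-shape substitution on $\mathbb{Z}^d$ with expansion matrix $L$. Then the repetitivity function satisfies $$M_{X_\zeta}(r)=\mathcal{O}\!\left(r^{-\frac{\log\|L\|}{\log\|L^{-1}\|}}\right).$$
   Context: Let $d\ge 1$; $\|\cdot\|$ is the Euclidean norm on $\mathbb{R}^d$ and the induced operator norm on matrices. For a finite alphabet $\mathcal{A}$, $\mathcal{A}^{\mathbb{Z}^d}$ carries the product topology and the shift action $(S^{n}x)_{k}=x_{n+k}$. A subshift is a closed shift-invariant subset; it is aperiodic if none of its points $x$ has a nonzero period (a $p\in\mathbb{Z}^d\setminus\{0\}$ with $x_{k+p}=x_k$ for all $k$). A pattern is an element $\mathtt{p}$ of $\mathcal{A}^P$ with $P=\operatorname{supp}(\mathtt{p})\subset\mathbb{Z}^d$ finite (identified up to translation of the support); $n\in\mathbb{Z}^d$ is an occurrence of $\mathtt{p}$ in $x$ if $x|_{n+P}=\mathtt{p}$. Constant-shape substitution: let $L$ be a $d\times d$ integer matrix with $\|L\|>1$, $\|L^{-1}\|<1$ (expansion matrix), and let $F_1\subset\mathbb{Z}^d$ be a set of representatives of $\mathbb{Z}^d/L(\mathbb{Z}^d)$ with $0\in F_1$ (support). A constant-shape substitution is a map $\zeta:\mathcal{A}\to\mathcal{A}^{F_1}$. It extends to $\mathcal{A}^{\mathbb{Z}^d}$ by $\zeta(x)_{L(j)+f}=\zeta(x_j)_f$ ($j\in\mathbb{Z}^d$, $f\in F_1$). Its iterates $\zeta^n:\mathcal{A}\to\mathcal{A}^{F_n}$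 have expansion matrix $L^n$ and support $F_n$, where $F_{n+1}=F_1+L(F_n)$, and $\zeta^{n+1}(a)_{L(g)+f}=\zeta(\zeta^n(a)_g)_f$ for $g\in F_n,f\in F_1$. Standing assumption: $(F_n)_{n>0}$ is a Følner sequence, i.e. $|F_n\,\Delta\,(m+F_n)|/|F_n|\to0$ for every $m\in\mathbb{Z}^d$. $\zeta$ is primitive if for some $n>0$ every letter occurs in $\zeta^n(a)$ for every $a\in\mathcal{A}$. $X_\zeta$ is the subshift of all $x\in\mathcal{A}^{\mathbb{Z}^d}$ such that every pattern occurring in $x$ occurs in some $\zeta^n(a)$, $n>0$, $a\in\mathcal{A}$. $\zeta$ is aperiodic if $X_\zeta$ is. Repetitivity function: assume $\zeta$ has a fixed point $x\in X_\zeta$ ($\zeta(x)=x$). For $r>0$, $M_{X_\zeta}(r)$ is the smallest radius such that every ball $B(n,M_{X_\zeta}(r))$, $n\in\mathbb{Z}^d$, contains an occurrence in $x$ of every pattern $\mathtt{p}$ occurring in $x$ with $\operatorname{diam}(\operatorname{supp}(\mathtt{p}))\le r$. The $\mathcal{O}$ is as $r\to\infty$. *)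

theory Defs
  imports "HOL-Analysis.Analysis" "HOL-Library.Landau_Symbols"
begin

section \<open>The lattice \<open>\<int>\<^sup>d\<close> inside Euclidean space\<close>

text \<open>
  The dimension is \<open>d = CARD('n)\<close>, which is at least 1. The library has no metric on
  \<open>int ^ 'n\<close>, so distances and diameters are taken after embedding into \<open>real ^ 'n\<close>.
\<close>

definition rvec :: "int ^ 'n \<Rightarrow> real ^ 'n" where
  "rvec k = (\<chi> i. real_of_int (k $ i))"

abbreviation rmat :: "int ^ 'n ^ 'n \<Rightarrow> real ^ 'n ^ 'n" where
  "rmat L \<equiv> map_matrix real_of_int L"

text \<open>
  The library's \<^const>\<open>norm\<close> on matrices is the Frobenius norm; the norm induced by the
  Euclidean norm is \<^const>\<open>onorm\<close> of the associated linear map.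
\<close>

definition opnorm :: "real ^ 'n ^ 'n \<Rightarrow> real" where
  "opnorm A = onorm ((*v) A)"

definition expansion_matrix :: "int ^ 'n ^ 'n \<Rightarrow> bool" where
  "expansion_matrix L \<longleftrightarrow>
     invertible (rmat L) \<and> opnorm (rmat L) > 1 \<and> opnorm (matrix_inv (rmat L)) < 1"


section \<open>Patterns and occurrences\<close>


text \<open>
  A pattern is a partial map on the lattice with finite domain, the domain being its support. Patterns are not
  quotiented by translation; every notion below is invariant under translating a pattern.
  Occurrences are defined in an arbitrary partial map \<open>q\<close>, so that they make sense both in
  a pattern and in a configuration \<open>x\<close>, viewed as the total map \<open>Some \<circ> x\<close>.
\<close>


definition occurs_at :: "(int ^ 'n \<rightharpoonup> 'a) \<Rightarrow> (int ^ 'n \<rightharpoonup> 'a) \<Rightarrow> int ^ 'n \<Rightarrow> bool" where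
  "occurs_at p q n \<longleftrightarrow> (\<forall>k \<in> dom p. q (n + k) = p k)"

definition occurs_in :: "(int ^ 'n \<rightharpoonup> 'a) \<Rightarrow> (int ^ 'n \<rightharpoonup> 'a) \<Rightarrow> bool" where
  "occurs_in p q \<longleftrightarrow> (\<exists>n. occurs_at p q n)"

definition aperiodic_set :: "(int ^ 'n \<Rightarrow> 'a) set \<Rightarrow> bool" where
  "aperiodic_set X \<longleftrightarrow> (\<forall>x \<in> X. \<not> (\<exists>p. p \<noteq> 0 \<and> (\<forall>k. x (k + p) = x k)))"


section \<open>Constant-shape substitutions\<close>

definition representatives :: "int ^ 'n ^ 'n \<Rightarrow> (int ^ 'n) set \<Rightarrow> bool" where
  "representatives L F \<longleftrightarrow> (\<forall>k. \<exists>!f. f \<in> F \<and> k - f \<in> range ((*v) L))"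

definition constant_shape_substitution ::
    "int ^ 'n ^ 'n \<Rightarrow> (int ^ 'n) set \<Rightarrow> ('a \<Rightarrow> (int ^ 'n \<rightharpoonup> 'a)) \<Rightarrow> bool" where
  "constant_shape_substitution L F \<zeta> \<longleftrightarrow>
     expansion_matrix L \<and> representatives L F \<and> 0 \<in> F \<and> (\<forall>a. dom (\<zeta> a) = F)"

text \<open>
  For a set \<open>F\<close> of representatives every \<open>k\<close> is uniquely \<open>L *v j + f\<close> with \<open>f \<in> F\<close>; here
  \<open>f = digit L F k\<close> and \<open>j = quot L F k\<close>.
\<close>

definition digit :: "int ^ 'n ^ 'n \<Rightarrow> (int ^ 'n) set \<Rightarrow> int ^ 'n \<Rightarrow> int ^ 'n" where
  "digit L F k = (THE f. f \<in> F \<and> k - f \<in> range ((*v) L))"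

definition quot :: "int ^ 'n ^ 'n \<Rightarrow> (int ^ 'n) set \<Rightarrow> int ^ 'n \<Rightarrow> int ^ 'n" where
  "quot L F k = (THE j. k - digit L F k = L *v j)"

definition subst_config ::
    "int ^ 'n ^ 'n \<Rightarrow> (int ^ 'n) set \<Rightarrow> ('a \<Rightarrow> (int ^ 'n \<rightharpoonup> 'a)) \<Rightarrow>
     (int ^ 'n \<Rightarrow> 'a) \<Rightarrow> (int ^ 'n \<Rightarrow> 'a)" where
  "subst_config L F \<zeta> x = (\<lambda>k. the (\<zeta> (x (quot L F k)) (digit L F k)))"

primrec supp_iter :: "int ^ 'n ^ 'n \<Rightarrow> (int ^ 'n) set \<Rightarrow> nat \<Rightarrow> (int ^ 'n) set" where
  "supp_iter L F 0 = {0}"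
| "supp_iter L F (Suc n) = {f + L *v g | f g. f \<in> F \<and> g \<in> supp_iter L F n}"

text \<open>
  \<open>subst_iter L F \<zeta> n a\<close> is the pattern \<open>\<zeta>\<^sup>n(a)\<close>, with support \<open>supp_iter L F n\<close>; see
  \<open>dom_subst_iter\<close> and \<open>subst_iter_Suc_eq\<close> below.
\<close>

primrec subst_iter ::
    "int ^ 'n ^ 'n \<Rightarrow> (int ^ 'n) set \<Rightarrow> ('a \<Rightarrow> (int ^ 'n \<rightharpoonup> 'a)) \<Rightarrow> nat \<Rightarrow>
     'a \<Rightarrow> (int ^ 'n \<rightharpoonup> 'a)" where
  "subst_iter L F \<zeta> 0 a = [0 \<mapsto> a]"
| "subst_iter L F \<zeta> (Suc n) a =
     (\<lambda>k. Option.bind (subst_iter L F \<zeta> n a (quot L F k)) (\<lambda>b. \<zeta> b (digit L F k)))"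

definition folner :: "(nat \<Rightarrow> (int ^ 'n) set) \<Rightarrow> bool" where
  "folner G \<longleftrightarrow>
     (\<forall>m. (\<lambda>n. real (card (sym_diff (G n) ((+) m ` G n))) / real (card (G n))) \<longlonglongrightarrow> 0)"

definition primitive ::
    "int ^ 'n ^ 'n \<Rightarrow> (int ^ 'n) set \<Rightarrow> ('a \<Rightarrow> (int ^ 'n \<rightharpoonup> 'a)) \<Rightarrow> bool" where
  "primitive L F \<zeta> \<longleftrightarrow> (\<exists>n>0. \<forall>a b. b \<in> ran (subst_iter L F \<zeta> n a))"

definition subst_subshift ::
    "int ^ 'n ^ 'n \<Rightarrow> (int ^ 'n) set \<Rightarrow> ('a \<Rightarrow> (int ^ 'n \<rightharpoonup> 'a)) \<Rightarrow> (int ^ 'n \<Rightarrow> 'a) set" where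
  "subst_subshift L F \<zeta> =
     {x. \<forall>p. finite (dom p) \<and> occurs_in p (Some \<circ> x) \<longrightarrow>
             (\<exists>n>0. \<exists>a. occurs_in p (subst_iter L F \<zeta> n a))}"


section \<open>The repetitivity function\<close>

definition repetitivity_radius :: "(int ^ 'n \<Rightarrow> 'a) \<Rightarrow> real \<Rightarrow> real \<Rightarrow> bool" where
  "repetitivity_radius x r R \<longleftrightarrow>
     (\<forall>n p. finite (dom p) \<and> occurs_in p (Some \<circ> x) \<and> diameter (rvec ` dom p) \<le> r \<longrightarrow>
            (\<exists>m. rvec m \<in> cball (rvec n) R \<and> occurs_at p (Some \<circ> x) m))"

text \<open>
  The balls are closed, so that a smallest radius exists; \<open>repetitivity_least\<close> below shows that
  it does for fixed points of primitive substitutions.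
\<close>

definition repetitivity :: "(int ^ 'n \<Rightarrow> 'a) \<Rightarrow> real \<Rightarrow> real" where
  "repetitivity x r = (LEAST R. repetitivity_radius x r R)"


section \<open>The definitions behave as intended\<close>

lemma rvec_mult: "rvec (L *v j) = rmat L *v rvec j"
  by (simp add: rvec_def matrix_vector_mult_def vec_eq_iff)

lemma rvec_add: "rvec (a + b) = rvec a + rvec b"
  by (simp add: rvec_def vec_eq_iff)

lemma rvec_diff: "rvec (a - b) = rvec a - rvec b"
  by (simp add: rvec_def vec_eq_iff)

lemma rvec_0: "rvec 0 = 0"
  by (simp add: rvec_def vec_eq_iff)

lemma int_mat_0: "(L :: int ^ 'n ^ 'n) *v 0 = 0"
  by (simp add: matrix_vector_mult_def vec_eq_iff)

lemma rvec_inj: "rvec a = rvec b \<longleftrightarrow> a = b"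
  by (simp add: rvec_def vec_eq_iff)

lemma expansion_matrix_inj:
  assumes "expansion_matrix L" "L *v i = L *v j"
  shows "i = j"
proof -
  have "invertible (rmat L)"
    using assms(1) by (simp add: expansion_matrix_def)
  then have "inj ((*v) (rmat L))"
    by (rule inj_matrix_vector_mult)
  moreover have "rmat L *v rvec i = rmat L *v rvec j"
    using arg_cong[OF assms(2), of rvec] by (simp only: rvec_mult)
  ultimately have "rvec i = rvec j" by (rule injD)
  then show ?thesis by (simp add: rvec_inj)
qed

lemma digit_quot:
  assumes "representatives L F" "expansion_matrix L"
  shows "digit L F k \<in> F" and "L *v quot L F k + digit L F k = k"
proof -
  have *: "digit L F k \<in> F \<and> k - digit L F k \<in> range ((*v) L)"
    unfolding digit_def using assms(1) theI'[of "\<lambda>f. f \<in> F \<and> k - f \<in> range ((*v) L)"]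
    by (auto simp: representatives_def)
  then show "digit L F k \<in> F" by blast
  from * obtain j where j: "k - digit L F k = L *v j" by blast
  have "quot L F k = j"
    unfolding quot_def j using expansion_matrix_inj[OF assms(2)] by (intro the_equality) auto
  with j show "L *v quot L F k + digit L F k = k" by (metis diff_add_cancel)
qed

lemma digit_quot_eq:
  assumes "representatives L F" "expansion_matrix L" "f \<in> F"
  shows "digit L F (L *v j + f) = f" and "quot L F (L *v j + f) = j"
proof -
  let ?k = "L *v j + f"
  have e: "L *v quot L F ?k + digit L F ?k = ?k" and d: "digit L F ?k \<in> F"
    using digit_quot[OF assms(1,2)] by auto
  have "?k - digit L F ?k = L *v quot L F ?k"
    using e by (metis add_diff_cancel_right')
  then have "?k - digit L F ?k \<in> range ((*v) L)" by (metis rangeI)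
  moreover have "?k - f \<in> range ((*v) L)" by simp
  ultimately show f: "digit L F ?k = f"
    using assms(1,3) d unfolding representatives_def by blast
  show "quot L F ?k = j"
    using e unfolding f by (auto intro: expansion_matrix_inj[OF assms(2)])
qed

lemma subst_config_eq:
  assumes "constant_shape_substitution L F \<zeta>" "f \<in> F"
  shows "\<zeta> (x j) f = Some (subst_config L F \<zeta> x (L *v j + f))"
proof -
  have "f \<in> dom (\<zeta> (x j))" using assms by (simp add: constant_shape_substitution_def)
  then obtain c where "\<zeta> (x j) f = Some c" by blast
  then show ?thesis
    using assms by (simp add: subst_config_def digit_quot_eq constant_shape_substitution_def)
qed

lemma supp_iter_1: "supp_iter L F 1 = F"
  by (simp add: int_mat_0)

lemma supp_iter_Suc_iff:
  assumes "representatives L F" "expansion_matrix L"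
  shows "k \<in> supp_iter L F (Suc n) \<longleftrightarrow> quot L F k \<in> supp_iter L F n"
proof
  assume "k \<in> supp_iter L F (Suc n)"
  then show "quot L F k \<in> supp_iter L F n"
    using digit_quot_eq[OF assms] by (auto simp: add.commute)
next
  assume "quot L F k \<in> supp_iter L F n"
  then show "k \<in> supp_iter L F (Suc n)"
    using digit_quot[OF assms, of k] by (force simp: add.commute)
qed

lemma dom_subst_iter:
  assumes "constant_shape_substitution L F \<zeta>"
  shows "dom (subst_iter L F \<zeta> n a) = supp_iter L F n"
proof (induction n)
  case (Suc n)
  have r: "representatives L F" "expansion_matrix L"
    using assms by (auto simp: constant_shape_substitution_def)
  have d: "\<exists>c. \<zeta> b (digit L F k) = Some c" for b k
    using assms digit_quot(1)[OF r, of k] by (auto simp: constant_shape_substitution_def)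
  have "k \<in> dom (subst_iter L F \<zeta> (Suc n) a) \<longleftrightarrow> quot L F k \<in> dom (subst_iter L F \<zeta> n a)" for k
    using d[of _ k] by (auto simp: bind_eq_Some_conv dom_def)
  then show ?case using Suc supp_iter_Suc_iff[OF r, of _ n] by blast
qed (auto split: if_splits)

lemma subst_iter_Suc_eq:
  assumes "constant_shape_substitution L F \<zeta>" "g \<in> supp_iter L F n" "f \<in> F"
  shows "subst_iter L F \<zeta> (Suc n) a (L *v g + f) = \<zeta> (the (subst_iter L F \<zeta> n a g)) f"
proof -
  have "g \<in> dom (subst_iter L F \<zeta> n a)" using assms by (simp add: dom_subst_iter)
  then show ?thesis
    using assms by (auto simp: digit_quot_eq constant_shape_substitution_def)
qed

lemma finite_lattice_ball: "finite {k :: int ^ 'n. norm (rvec k) \<le> r}"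
proof -
  let ?S = "{- \<lceil>r\<rceil>..\<lceil>r\<rceil>}"
  have "{k :: int ^ 'n. norm (rvec k) \<le> r} \<subseteq> (\<lambda>h. \<chi> i. h i) ` (UNIV \<rightarrow>\<^sub>E ?S)"
  proof
    fix k :: "int ^ 'n"
    assume "k \<in> {k. norm (rvec k) \<le> r}"
    then have "norm (rvec k) \<le> r" by simp
    then have "\<bar>real_of_int (k $ i)\<bar> \<le> r" for i
      using component_le_norm_cart[of "rvec k" i] by (simp add: rvec_def)
    then have "\<bar>k $ i\<bar> \<le> \<lceil>r\<rceil>" for i
      by (metis ceiling_mono ceiling_of_int of_int_abs)
    then have "k $ i \<in> ?S" for i by (simp add: abs_le_iff minus_le_iff)
    then have "(\<lambda>i. k $ i) \<in> UNIV \<rightarrow>\<^sub>E ?S" by auto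
    moreover have "k = (\<chi> i. k $ i)" by simp
    ultimately show "k \<in> (\<lambda>h. \<chi> i. h i) ` (UNIV \<rightarrow>\<^sub>E ?S)" by blast
  qed
  moreover have "finite ((UNIV :: 'n set) \<rightarrow>\<^sub>E ?S)" by (intro finite_PiE) auto
  ultimately show ?thesis by (meson finite_imageI finite_subset)
qed

lemma finite_representatives:
  fixes L :: "int ^ 'n ^ 'n"
  assumes "representatives L F" "expansion_matrix L"
  shows "finite F"
proof -
  let ?A = "rmat L" and ?B = "matrix_inv (rmat L)"
  define fl :: "int ^ 'n \<Rightarrow> int ^ 'n" where "fl k = (\<chi> i. \<lfloor>(?B *v rvec k) $ i\<rfloor>)" for k
  define h where "h k = k - L *v fl k" for k
  have inv: "?A ** ?B = mat 1"
    using assms(2) someI_ex[of "\<lambda>A'. ?A ** A' = mat 1 \<and> A' ** ?A = mat 1"]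
    by (auto simp: expansion_matrix_def invertible_def matrix_inv_def)
  obtain K where K: "norm (?A *v v) \<le> norm v * K" "K \<ge> 0" for v
    using bounded_linear.nonneg_bounded[of "(*v) ?A"] matrix_vector_mul_bounded_linear by blast
  have "norm (rvec (h k)) \<le> real CARD('n) * K" for k
  proof -
    let ?v = "?B *v rvec k - rvec (fl k)"
    have "?A *v (?B *v rvec k) = rvec k"
      by (simp add: matrix_vector_mul_assoc inv)
    then have e: "rvec (h k) = ?A *v ?v"
      by (simp add: h_def rvec_diff rvec_mult matrix_vector_mult_diff_distrib)
    have "norm ?v \<le> (\<Sum>i\<in>UNIV. \<bar>?v $ i\<bar>)" by (rule norm_le_l1_cart)
    moreover have "\<dots> \<le> (\<Sum>i\<in>(UNIV :: 'n set). 1)"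
      by (intro sum_mono) (simp add: rvec_def fl_def abs_le_iff, linarith)
    ultimately have "norm ?v \<le> real CARD('n)" by simp
    then have "norm ?v * K \<le> real CARD('n) * K" using K(2) by (rule mult_right_mono)
    with K(1)[of ?v] show ?thesis unfolding e by linarith
  qed
  then have "finite (h ` F)"
    by (intro finite_subset[OF _ finite_lattice_ball[of "real CARD('n) * K"]]) auto
  moreover have "inj_on h F"
  proof (rule inj_onI)
    fix a b assume ab: "a \<in> F" "b \<in> F" "h a = h b"
    have "a - b = L *v (fl a - fl b)"
      using ab(3) by (simp add: h_def matrix_vector_mult_diff_distrib algebra_simps)
    then have "a - b \<in> range ((*v) L)" by (metis rangeI)
    moreover have "a - a = L *v 0" by (simp add: int_mat_0)
    then have "a - a \<in> range ((*v) L)" by (metis rangeI)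
    ultimately show "a = b" using assms(1) ab unfolding representatives_def by blast
  qed
  ultimately show ?thesis by (metis finite_imageD)
qed

lemma finite_supp_iter:
  assumes "representatives L F" "expansion_matrix L"
  shows "finite (supp_iter L F n)"
proof (induction n)
  case (Suc n)
  have "supp_iter L F (Suc n) = (\<lambda>(f, g). f + L *v g) ` (F \<times> supp_iter L F n)" by force
  then show ?case using Suc finite_representatives[OF assms] by simp
qed simp

lemma lattice_decompose:
  assumes "representatives L F" "expansion_matrix L"
  shows "\<exists>j. \<exists>f \<in> supp_iter L F n. k = ((*v) L ^^ n) j + f"
proof (induction n arbitrary: k)
  case (Suc n)
  obtain j f where jf: "f \<in> supp_iter L F n" "quot L F k = ((*v) L ^^ n) j + f"
    using Suc by blast
  have "k = ((*v) L ^^ Suc n) j + (digit L F k + L *v f)"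
    using digit_quot(2)[OF assms, of k] by (simp add: jf(2) matrix_vector_right_distrib ac_simps)
  moreover have "digit L F k + L *v f \<in> supp_iter L F (Suc n)"
    using jf(1) digit_quot(1)[OF assms, of k] by auto
  ultimately show ?case by blast
qed simp

lemma fixed_point_iter:
  assumes "constant_shape_substitution L F \<zeta>" "subst_config L F \<zeta> x = x"
    and "f \<in> supp_iter L F n"
  shows "subst_iter L F \<zeta> n (x j) f = Some (x (((*v) L ^^ n) j + f))"
  using assms(3)
proof (induction n arbitrary: f)
  case (Suc n)
  then obtain e g where eg: "f = L *v g + e" "e \<in> F" "g \<in> supp_iter L F n"
    by (auto simp: add.commute)
  have "subst_iter L F \<zeta> (Suc n) (x j) f = \<zeta> (x (((*v) L ^^ n) j + g)) e"
    unfolding eg(1) by (subst subst_iter_Suc_eq[OF assms(1) eg(3,2)]) (simp add: Suc.IH[OF eg(3)])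
  also have "\<dots> = Some (x (L *v (((*v) L ^^ n) j + g) + e))"
    using subst_config_eq[OF assms(1) eg(2), of x] by (simp add: assms(2))
  finally show ?case by (simp add: eg(1) matrix_vector_right_distrib add.assoc)
qed simp

lemma pattern_repetitive:
  fixes x :: "(int ^ 'n \<Rightarrow> 'a)"
  assumes cs: "constant_shape_substitution L F \<zeta>" and "primitive L F \<zeta>"
    and "x \<in> subst_subshift L F \<zeta>" and fp: "subst_config L F \<zeta> x = x"
    and "finite (dom p)" "occurs_in p (Some \<circ> x)"
  shows "\<exists>R. \<forall>n. \<exists>m. norm (rvec (m - n)) \<le> R \<and> occurs_at p (Some \<circ> x) m"
proof -
  have r: "representatives L F" "expansion_matrix L"
    using cs by (auto simp: constant_shape_substitution_def)
  let ?P = "\<lambda>n. ((*v) L) ^^ n"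
  have P_add: "?P n (u + v) = ?P n u + ?P n v" for n u v
    by (induction n) (simp_all add: matrix_vector_right_distrib)
  obtain n a m0 where occ: "occurs_at p (subst_iter L F \<zeta> n a) m0"
    using assms(3,5,6) unfolding subst_subshift_def occurs_in_def by blast
  obtain N where N: "\<And>b. a \<in> ran (subst_iter L F \<zeta> N b)"
    using assms(2) unfolding primitive_def by blast
  let ?S = "(\<lambda>(g, f). norm (rvec (?P n g + m0 - f))) ` (supp_iter L F N \<times> supp_iter L F (n + N))"
  have "finite ?S" using finite_supp_iter[OF r] by blast
  then have "bdd_above ?S" by (rule bdd_above_finite)
  then obtain R where R: "\<And>y. y \<in> ?S \<Longrightarrow> y \<le> R" unfolding bdd_above_def by blast
  have "\<exists>m. norm (rvec (m - k)) \<le> R \<and> occurs_at p (Some \<circ> x) m" for k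
  proof -
    obtain j f where jf: "f \<in> supp_iter L F (n + N)" "k = ?P (n + N) j + f"
      using lattice_decompose[OF r] by blast
    obtain g where g: "subst_iter L F \<zeta> N (x j) g = Some a"
      using N[of "x j"] by (auto simp: ran_def)
    then have gs: "g \<in> supp_iter L F N" using dom_subst_iter[OF cs, of N "x j"] by blast
    define l where "l = ?P N j + g"
    have xl: "x l = a" using fixed_point_iter[OF cs fp gs, of j] g by (simp add: l_def)
    define m where "m = ?P n l + m0"
    have "m - k = ?P n g + m0 - f"
      by (simp add: m_def l_def jf(2) P_add funpow_add)
    then have "norm (rvec (m - k)) \<in> ?S" using gs jf(1) by (auto intro!: image_eqI[of _ _ "(g, f)"])
    moreover have "occurs_at p (Some \<circ> x) m"
      unfolding occurs_at_def
    proof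
      fix i assume i: "i \<in> dom p"
      have e: "subst_iter L F \<zeta> n a (m0 + i) = p i" using occ i by (auto simp: occurs_at_def)
      then have "m0 + i \<in> supp_iter L F n"
        using i dom_subst_iter[OF cs, of n a] by (metis domIff)
      then have "subst_iter L F \<zeta> n (x l) (m0 + i) = Some (x (?P n l + (m0 + i)))"
        by (rule fixed_point_iter[OF cs fp])
      then show "(Some \<circ> x) (m + i) = p i" using e xl by (simp add: m_def add.assoc)
    qed
    ultimately show ?thesis using R by blast
  qed
  then show ?thesis by blast
qed

lemma norm_rvec_diff: "rvec m \<in> cball (rvec n) R \<longleftrightarrow> norm (rvec (m - n)) \<le> R"
  by (simp add: dist_norm rvec_diff norm_minus_commute)

lemma occurs_at_translate:
  "occurs_at (\<lambda>k. p (k + v)) q n \<longleftrightarrow> occurs_at p q (n - v)"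
proof -
  have *: "k + v \<in> dom p \<longleftrightarrow> k \<in> dom (\<lambda>k. p (k + v))" for k by auto
  show ?thesis unfolding occurs_at_def
  proof safe
    fix k y assume "\<forall>k\<in>dom (\<lambda>k. p (k + v)). q (n + k) = p (k + v)" "p k = Some y"
    then have "q (n + (k - v)) = p (k - v + v)" by (metis domI diff_add_cancel)
    then show "q (n - v + k) = p k" by (simp add: algebra_simps)
  next
    fix k y assume a: "\<forall>k\<in>dom p. q (n - v + k) = p k" "p (k + v) = Some y"
    then have "q (n - v + (k + v)) = p (k + v)" by blast
    then show "q (n + k) = p (k + v)" by (simp add: algebra_simps)
  qed
qed

lemma repetitivity_radius_ex:
  fixes x :: "int ^ 'n \<Rightarrow> 'a::finite"
  assumes "constant_shape_substitution L F \<zeta>" "primitive L F \<zeta>"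
    and "x \<in> subst_subshift L F \<zeta>" "subst_config L F \<zeta> x = x"
  shows "\<exists>R. repetitivity_radius x r R"
proof -
  let ?B = "{k :: int ^ 'n. norm (rvec k) \<le> r}"
  define Q where "Q = {p :: (int ^ 'n \<rightharpoonup> 'a). dom p \<subseteq> ?B \<and> occurs_in p (Some \<circ> x)}"
  have finB: "finite ?B" by (rule finite_lattice_ball)
  have "Q \<subseteq> (\<Union>A \<in> Pow ?B. {p. dom p = A \<and> ran p \<subseteq> UNIV})" by (auto simp: Q_def)
  moreover have "finite (\<Union>A \<in> Pow ?B. {p :: (int ^ 'n \<rightharpoonup> 'a). dom p = A \<and> ran p \<subseteq> UNIV})"
    using finB finite_subset[OF _ finB] by (intro finite_UN_I finite_set_of_finite_maps) simp_all
  ultimately have finQ: "finite Q" by (rule finite_subset)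
  have "\<forall>p \<in> Q. \<exists>R. \<forall>n. \<exists>m. norm (rvec (m - n)) \<le> R \<and> occurs_at p (Some \<circ> x) m"
    using pattern_repetitive[OF assms] finite_subset[OF _ finB] by (auto simp: Q_def)
  then obtain h where
    h: "\<And>p n. p \<in> Q \<Longrightarrow> \<exists>m. norm (rvec (m - n)) \<le> h p \<and> occurs_at p (Some \<circ> x) m"
    by metis
  define R where "R = Max (insert 0 (h ` Q))"
  have R: "0 \<le> R" "p \<in> Q \<Longrightarrow> h p \<le> R" for p using finQ by (auto simp: R_def)
  have "repetitivity_radius x r R"
    unfolding repetitivity_radius_def norm_rvec_diff
  proof (intro allI impI, elim conjE)
    fix n and p :: "(int ^ 'n \<rightharpoonup> 'a)"
    assume p: "finite (dom p)" "occurs_in p (Some \<circ> x)" "diameter (rvec ` dom p) \<le> r"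
    show "\<exists>m. norm (rvec (m - n)) \<le> R \<and> occurs_at p (Some \<circ> x) m"
    proof (cases "dom p = {}")
      case True
      then have "occurs_at p (Some \<circ> x) n" by (simp add: occurs_at_def)
      moreover have "norm (rvec (n - n)) \<le> R" using R(1) by (simp add: rvec_0)
      ultimately show ?thesis by blast
    next
      case False
      then obtain v where v: "v \<in> dom p" by blast
      define p' where "p' = (\<lambda>k. p (k + v))"
      have "norm (rvec k) \<le> r" if "k \<in> dom p'" for k
      proof -
        have "k + v \<in> dom p" using that by (auto simp: p'_def)
        then have "dist (rvec (k + v)) (rvec v) \<le> diameter (rvec ` dom p)"
          using v p(1) by (intro diameter_bounded_bound) (auto intro: finite_imp_bounded)
        then show ?thesis using p(3) by (simp add: rvec_add dist_norm)
      qed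
      moreover have "occurs_in p' (Some \<circ> x)"
        using p(2) unfolding occurs_in_def p'_def occurs_at_translate
        by (metis add_diff_cancel_right')
      ultimately have "p' \<in> Q" by (auto simp: Q_def)
      with h obtain m where
        m: "norm (rvec (m - (n + v))) \<le> h p'" "occurs_at p' (Some \<circ> x) m" by blast
      have "occurs_at p (Some \<circ> x) (m - v)"
        using m(2) by (simp add: p'_def occurs_at_translate)
      moreover have "norm (rvec (m - v - n)) \<le> R"
        using m(1) R(2)[OF \<open>p' \<in> Q\<close>] by (simp add: algebra_simps)
      ultimately show ?thesis by blast
    qed
  qed
  then show ?thesis by blast
qed

lemma repetitivity_radius_nonneg:
  fixes x :: "int ^ 'n \<Rightarrow> 'a"
  assumes "repetitivity_radius x r R" "r \<ge> 0"
  shows "0 \<le> R"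
proof -
  let ?p = "Map.empty :: int ^ 'n \<rightharpoonup> 'a"
  have "occurs_in ?p (Some \<circ> x)" by (simp add: occurs_in_def occurs_at_def)
  moreover have "diameter (rvec ` dom ?p) \<le> r" "finite (dom ?p)" using assms(2) by simp_all
  ultimately obtain m :: "int ^ 'n" where "rvec m \<in> cball (rvec 0) R"
    using assms(1) unfolding repetitivity_radius_def by blast
  then have "dist (rvec 0) (rvec m) \<le> R" by simp
  then show ?thesis using zero_le_dist order_trans by blast
qed

theorem repetitivity_least:
  fixes x :: "int ^ 'n \<Rightarrow> 'a::finite"
  assumes "constant_shape_substitution L F \<zeta>" "primitive L F \<zeta>"
    and "x \<in> subst_subshift L F \<zeta>" "subst_config L F \<zeta> x = x" and "r \<ge> 0"
  shows "repetitivity_radius x r (repetitivity x r)"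
    and "repetitivity_radius x r R \<Longrightarrow> repetitivity x r \<le> R"
proof -
  let ?S = "{R. repetitivity_radius x r R}"
  define I where "I = Inf ?S"
  have ne: "?S \<noteq> {}" using repetitivity_radius_ex[OF assms(1-4)] by blast
  have bdd: "bdd_below ?S" using repetitivity_radius_nonneg[OF _ assms(5)] by (auto intro!: bdd_belowI)
  have I: "repetitivity_radius x r I"
    unfolding repetitivity_radius_def
  proof (intro allI impI)
    fix n and p :: "(int ^ 'n \<rightharpoonup> 'a)"
    assume p: "finite (dom p) \<and> occurs_in p (Some \<circ> x) \<and> diameter (rvec ` dom p) \<le> r"
    define T where "T = {m. norm (rvec (m - n)) \<le> I + 1 \<and> occurs_at p (Some \<circ> x) m}"
    have "(\<lambda>m. m - n) ` T \<subseteq> {k. norm (rvec k) \<le> I + 1}" by (auto simp: T_def)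
    then have "finite ((\<lambda>m. m - n) ` T)" by (rule finite_subset[OF _ finite_lattice_ball])
    then have finT: "finite T" by (rule finite_imageD) (simp add: inj_on_def)
    have *: "\<exists>m \<in> T. norm (rvec (m - n)) < I + e" if "0 < e" "e \<le> 1" for e
    proof -
      have "Inf ?S < I + e" using that(1) by (simp add: I_def)
      then have "\<exists>R \<in> ?S. R < I + e" by (rule cInf_lessD[OF ne])
      then obtain R where "R \<in> ?S" "R < I + e" by blast
      then obtain m where "norm (rvec (m - n)) \<le> R" "occurs_at p (Some \<circ> x) m"
        using p unfolding mem_Collect_eq repetitivity_radius_def norm_rvec_diff by blast
      moreover from this have "m \<in> T" using \<open>R < I + e\<close> that(2) by (simp add: T_def)
      ultimately show ?thesis using \<open>R < I + e\<close> by (intro bexI[of _ m]) simp_all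
    qed
    show "\<exists>m. rvec m \<in> cball (rvec n) I \<and> occurs_at p (Some \<circ> x) m"
    proof (rule ccontr)
      assume no: "\<not> ?thesis"
      define \<delta> where "\<delta> = Min (insert 1 ((\<lambda>m. norm (rvec (m - n)) - I) ` T))"
      have "norm (rvec (m - n)) > I" if "m \<in> T" for m
        using no that unfolding norm_rvec_diff T_def by (metis (no_types, lifting) mem_Collect_eq not_le)
      then have "0 < \<delta>" "\<delta> \<le> 1" using finT by (auto simp: \<delta>_def)
      then obtain m where m: "m \<in> T" "norm (rvec (m - n)) < I + \<delta>" using *[of \<delta>] by blast
      then have "\<delta> \<le> norm (rvec (m - n)) - I" using finT by (auto simp: \<delta>_def)
      with m show False by simp
    qed
  qed
  have le: "I \<le> R" if "repetitivity_radius x r R" for R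
    unfolding I_def using that by (intro cInf_lower[OF _ bdd]) auto
  have eq: "repetitivity x r = I"
    unfolding repetitivity_def using I le by (rule Least_equality)
  show "repetitivity_radius x r (repetitivity x r)" using I eq by simp
  show "repetitivity_radius x r R \<Longrightarrow> repetitivity x r \<le> R" using le eq by simp
qed

end

theory Submission
  imports Defs
begin

text \<open>
  Desubstitute \<open>n\<close> times, where \<open>n\<close> is least with \<open>r \<parallel>L\<^sup>-\<^sup>1\<parallel>\<^sup>n \<le> 1\<close>. Since the sets
  \<open>L\<^sup>-\<^sup>n F\<^sub>n\<close> are uniformly bounded, a pattern of diameter at most \<open>r\<close> in the fixed point is
  determined by a pattern whose diameter is bounded independently of \<open>r\<close>. The latter recurs
  within a constant distance \<open>R\<close>, hence the former within a constant multiple of \<open>\<parallel>L\<parallel>\<^sup>n\<close>, and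
  \<open>\<parallel>L\<parallel>\<^sup>n\<close> is at most \<open>\<parallel>L\<parallel>\<close> times the claimed power of \<open>r\<close>.
\<close>

lemma norm_le_opnorm: "norm (A *v v) \<le> opnorm A * norm v"
  unfolding opnorm_def by (rule onorm) simp

lemma invertible_matrix_inv:
  fixes A :: "real ^ 'n ^ 'n"
  assumes "invertible A"
  shows "A ** matrix_inv A = mat 1" "matrix_inv A ** A = mat 1"
  using assms someI_ex[of "\<lambda>B. A ** B = mat 1 \<and> B ** A = mat 1"]
  by (auto simp: invertible_def matrix_inv_def)

text \<open>An inverse cannot annihilate every vector. Together with the upper bound in
  \<open>expansion_matrix\<close> this makes the logarithm in the denominator of the exponent
  strictly negative.\<close>

lemma opnorm_matrix_inv_pos:
  fixes A :: "real ^ 'n ^ 'n"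
  assumes "invertible A"
  shows "opnorm (matrix_inv A) > 0"
proof -
  obtain w :: "real ^ 'n" where w: "w \<noteq> 0" using zero_neq_one by metis
  have "matrix_inv A *v (A *v w) = w"
    by (simp add: matrix_vector_mul_assoc invertible_matrix_inv[OF assms])
  then have "norm w \<le> opnorm (matrix_inv A) * norm (A *v w)" by (metis norm_le_opnorm)
  moreover have "0 < norm w" using w by simp
  ultimately have "0 < opnorm (matrix_inv A) * norm (A *v w)" by linarith
  then show ?thesis by (simp add: zero_less_mult_iff)
qed

lemma norm_funpow_le:
  "norm (((*v) A ^^ n) v) \<le> opnorm A ^ n * norm v"
proof (induction n)
  case (Suc n)
  have "0 \<le> opnorm A" unfolding opnorm_def by (rule onorm_pos_le) simp
  then show ?case
    using order_trans[OF norm_le_opnorm mult_left_mono[OF Suc.IH]]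
    by (simp add: mult.assoc)
qed simp

lemma funpow_add_distrib:
  "((*v) A ^^ n) (u + v) = ((*v) A ^^ n) u + ((*v) A ^^ n) v"
  for A :: "'a::comm_ring_1 ^ 'n ^ 'n"
  by (induction n) (simp_all add: matrix_vector_right_distrib)

lemma funpow_diff_distrib:
  "((*v) A ^^ n) (u - v) = ((*v) A ^^ n) u - ((*v) A ^^ n) v"
  for A :: "'a::comm_ring_1 ^ 'n ^ 'n"
  by (induction n) (simp_all add: matrix_vector_mult_diff_distrib)

lemma rvec_funpow: "rvec (((*v) L ^^ n) v) = ((*v) (rmat L) ^^ n) (rvec v)"
  by (induction n) (simp_all add: rvec_mult)

lemma funpow_matrix_inv:
  fixes A :: "real ^ 'n ^ 'n"
  assumes "invertible A"
  shows "((*v) A ^^ n) (((*v) (matrix_inv A) ^^ n) v) = v"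
    and "((*v) (matrix_inv A) ^^ n) (((*v) A ^^ n) v) = v"
proof -
  have *: "A *v (matrix_inv A *v w) = w" "matrix_inv A *v (A *v w) = w" for w
    by (simp_all add: matrix_vector_mul_assoc invertible_matrix_inv[OF assms])
  show "((*v) A ^^ n) (((*v) (matrix_inv A) ^^ n) v) = v"
    by (induction n arbitrary: v) (simp_all add: funpow_swap1 *)
  show "((*v) (matrix_inv A) ^^ n) (((*v) A ^^ n) v) = v"
    by (induction n arbitrary: v) (simp_all add: funpow_swap1 *)
qed

text \<open>A point of \<open>supp_iter L F n\<close> is a sum of terms \<open>L^i\<close> applied
  to a digit in \<open>F\<close>, with \<open>i < n\<close>. Applying \<open>L^(-n)\<close> turns it
  into a sum dominated by a geometric series of ratio \<mu> < 1, so \<open>C\<close> =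
  \<open>K / (1 - \<mu>)\<close> serves all \<open>n\<close> at once.\<close>

lemma supp_iter_bounded:
  assumes "representatives L F" "expansion_matrix L"
  shows "\<exists>C\<ge>0. \<forall>n. \<forall>f \<in> supp_iter L F n. \<exists>u. norm u \<le> C \<and> rvec f = ((*v) (rmat L) ^^ n) u"
proof -
  let ?A = "rmat L"
  define \<mu> where "\<mu> = opnorm (matrix_inv ?A)"
  have inv: "invertible ?A" and \<mu>: "0 \<le> \<mu>" "\<mu> < 1"
    using assms(2) opnorm_matrix_inv_pos[of ?A] by (auto simp: expansion_matrix_def \<mu>_def)
  obtain K where K: "0 \<le> K" "\<And>f. f \<in> F \<Longrightarrow> norm (rvec f) \<le> K"
  proof
    show "0 \<le> Max (insert 0 ((\<lambda>f. norm (rvec f)) ` F))"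
      "\<And>f. f \<in> F \<Longrightarrow> norm (rvec f) \<le> Max (insert 0 ((\<lambda>f. norm (rvec f)) ` F))"
      using finite_representatives[OF assms] by auto
  qed
  have *: "\<exists>u. norm u \<le> K * (\<Sum>i<n. \<mu> ^ i) \<and> rvec f = ((*v) ?A ^^ n) u"
    if "f \<in> supp_iter L F n" for n f
    using that
  proof (induction n arbitrary: f)
    case 0
    then show ?case by (intro exI[of _ 0]) (simp add: rvec_0)
  next
    case (Suc n)
    then obtain e g where eg: "f = e + L *v g" "e \<in> F" "g \<in> supp_iter L F n" by auto
    obtain u where u: "norm u \<le> K * (\<Sum>i<n. \<mu> ^ i)" "rvec g = ((*v) ?A ^^ n) u"
      using Suc.IH[OF eg(3)] by blast
    define w where "w = ((*v) (matrix_inv ?A) ^^ Suc n) (rvec e)"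
    have "norm w \<le> \<mu> ^ Suc n * norm (rvec e)"
      unfolding w_def \<mu>_def by (rule norm_funpow_le)
    \<comment> \<open>One factor \<mu> is given up, so that the bound is exactly the next term of
      the geometric sum.\<close>
    also have "\<dots> \<le> \<mu> ^ n * K"
      using \<mu> K(1) K(2)[OF eg(2)]
      by (intro mult_mono) (auto intro: mult_left_le_one_le)
    finally have "norm (u + w) \<le> K * (\<Sum>i<Suc n. \<mu> ^ i)"
      using u(1) norm_triangle_ineq[of u w] by (simp add: algebra_simps)
    moreover have "((*v) ?A ^^ Suc n) w = rvec e"
      unfolding w_def by (rule funpow_matrix_inv(1)[OF inv])
    then have "rvec f = ((*v) ?A ^^ Suc n) (u + w)"
      by (simp only: funpow_add_distrib) (simp add: eg(1) rvec_add rvec_mult u(2))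
    ultimately show ?case by blast
  qed
  have "(\<Sum>i<n. \<mu> ^ i) \<le> 1 / (1 - \<mu>)" for n
    using \<mu> sum_le_suminf[of "\<lambda>i. \<mu> ^ i" "{..<n}"]
    by (simp add: summable_geometric suminf_geometric)
  then have "K * (\<Sum>i<n. \<mu> ^ i) \<le> K * (1 / (1 - \<mu>))" for n
    using K(1) by (rule mult_left_mono)
  moreover have "0 \<le> K * (1 / (1 - \<mu>))" using K(1) \<mu> by simp
  ultimately show ?thesis using * by (meson order_trans)
qed

text \<open>A fixed point of the substitution is fixed by its \<open>n\<close>-th iterate too, so
  both sides are the entry at \<open>f\<close> of the \<open>n\<close>-th image of the common
  letter.\<close>

lemma fixed_point_desubstitute:
  assumes "constant_shape_substitution L F \<zeta>" "subst_config L F \<zeta> x = x"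
    and "f \<in> supp_iter L F n" "x i = x j"
  shows "x (((*v) L ^^ n) i + f) = x (((*v) L ^^ n) j + f)"
  using fixed_point_iter[OF assms(1-3), of i] fixed_point_iter[OF assms(1-3), of j] assms(4) by simp

text \<open>The constant \<open>R\<close> is chosen before \<open>n\<close> and \<open>r\<close>,
  which leaves \<open>n\<close> free to be fitted to \<open>r\<close> afterwards.\<close>

lemma repetitivity_radius_scale:
  fixes x :: "int ^ 'n \<Rightarrow> 'a::finite"
  assumes cs: "constant_shape_substitution L F \<zeta>" and "primitive L F \<zeta>"
    and "x \<in> subst_subshift L F \<zeta>" and fp: "subst_config L F \<zeta> x = x"
  shows "\<exists>R. \<forall>n r. r * opnorm (matrix_inv (rmat L)) ^ n \<le> 1 \<longrightarrow>
                   repetitivity_radius x r (opnorm (rmat L) ^ n * R)"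
proof -
  let ?A = "rmat L"
  let ?P = "\<lambda>n. ((*v) L) ^^ n"
  define \<mu> where "\<mu> = opnorm (matrix_inv ?A)"
  have rep: "representatives L F" "expansion_matrix L"
    using cs by (auto simp: constant_shape_substitution_def)
  then have inv: "invertible ?A" by (simp add: expansion_matrix_def)
  have \<mu>0: "0 \<le> \<mu>" using opnorm_matrix_inv_pos[OF inv] by (simp add: \<mu>_def)
  obtain C where C: "0 \<le> C"
    "\<And>n f. f \<in> supp_iter L F n \<Longrightarrow> \<exists>u. norm u \<le> C \<and> rvec f = ((*v) ?A ^^ n) u"
    using supp_iter_bounded[OF rep] by blast
  \<comment> \<open>After rescaling by \<open>L^(-n)\<close>, a displacement of length at most
    \<open>r\<close> has length at most 1, and each of the two remainders at its ends adds at most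
    \<open>C\<close>.\<close>
  obtain R where R: "repetitivity_radius x (1 + 2 * C) R"
    using repetitivity_radius_ex[OF assms] by blast
  \<comment> \<open>In units of \<open>L^n\<close>, \<open>R\<close> accounts for the recurrence of
    the reduced pattern and \<open>C\<close> for the remainder left when the centre is rounded to a
    multiple of \<open>L^n\<close>.\<close>
  have "repetitivity_radius x r (opnorm ?A ^ n * (R + C))" if n: "r * \<mu> ^ n \<le> 1" for n r
    unfolding repetitivity_radius_def norm_rvec_diff
  proof (intro allI impI, elim conjE)
    fix c and p :: "(int ^ 'n \<rightharpoonup> 'a)"
    assume p: "finite (dom p)" "occurs_in p (Some \<circ> x)" "diameter (rvec ` dom p) \<le> r"
    obtain m0 where m0: "\<And>k. k \<in> dom p \<Longrightarrow> Some (x (m0 + k)) = p k"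
      using p(2) by (auto simp: occurs_in_def occurs_at_def)
    \<comment> \<open>\<open>J k\<close> is the letter of \<open>x\<close> whose \<open>n\<close>-th
      image covers the site \<open>m0 + k\<close>, and \<open>G k\<close> is the place of that site
      inside the image.\<close>
    obtain J G where G: "\<And>k. G k \<in> supp_iter L F n" and JG: "\<And>k. m0 + k = ?P n (J k) + G k"
      proof -
      have "\<forall>k. \<exists>j f. f \<in> supp_iter L F n \<and> m0 + k = ?P n j + f"
        using lattice_decompose[OF rep, of n] by blast
      then show ?thesis using that by metis
    qed
    have J_close: "norm (rvec (J k) - rvec (J l)) \<le> 1 + 2 * C" if kl: "k \<in> dom p" "l \<in> dom p" for k l
    proof -
      obtain u v where u: "norm u \<le> C" "rvec (G k) = ((*v) ?A ^^ n) u"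
        and v: "norm v \<le> C" "rvec (G l) = ((*v) ?A ^^ n) v"
        using C(2)[OF G] by metis
      \<comment> \<open>This is \<open>k - l\<close> pulled back by \<open>L^(-n)\<close>, hence
        \<open>J k - J l\<close> corrected by the rescaled remainders.\<close>
      define w where "w = (rvec (J k) + u) - (rvec (J l) + v)"
      have "((*v) ?A ^^ n) w = rvec (m0 + k) - rvec (m0 + l)"
        by (simp add: w_def funpow_diff_distrib funpow_add_distrib JG rvec_add rvec_funpow u v)
      then have e: "((*v) ?A ^^ n) w = rvec k - rvec l" by (simp add: rvec_add)
      have "dist (rvec k) (rvec l) \<le> diameter (rvec ` dom p)"
        using kl p(1) by (intro diameter_bounded_bound) (auto intro: finite_imp_bounded)
      then have d: "norm (rvec k - rvec l) \<le> r" using p(3) by (simp add: dist_norm)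
      have "norm w \<le> \<mu> ^ n * norm (rvec k - rvec l)"
        using norm_funpow_le[where A = "matrix_inv ?A" and n = n and v = "((*v) ?A ^^ n) w"]
        unfolding funpow_matrix_inv(2)[OF inv] by (simp add: e \<mu>_def)
      also have "\<dots> \<le> \<mu> ^ n * r" using d \<mu>0 by (intro mult_left_mono) auto
      finally have "norm w \<le> 1" using n by (simp add: mult.commute)
      moreover have "rvec (J k) - rvec (J l) = w + (v - u)" by (simp add: w_def)
      ultimately show ?thesis
        using u(1) v(1) norm_triangle_ineq[of w "v - u"] norm_triangle_ineq4[of v u] by simp
    qed
    \<comment> \<open>The reduced pattern: the letters of \<open>x\<close> that generate the given
      occurrence of \<open>p\<close>, kept at their own positions, so that it occurs at 0.\<close>
    define q where "q = (Some \<circ> x) |` (J ` dom p)"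
    have dq: "dom q = J ` dom p" by (auto simp: q_def)
    have q1: "finite (dom q)" using p(1) by (simp add: dq)
    have "occurs_at q (Some \<circ> x) 0" by (simp add: occurs_at_def q_def)
    then have q2: "occurs_in q (Some \<circ> x)" by (auto simp: occurs_in_def)
    have q3: "diameter (rvec ` dom q) \<le> 1 + 2 * C"
      using C(1) J_close by (intro diameter_le) (auto simp: dq)
    \<comment> \<open>Moving \<open>q\<close> by \<open>m\<close> moves the occurrence of
      \<open>p\<close> from \<open>m0\<close> by \<open>L^n m\<close>. To land near
      \<open>c\<close>, \<open>m\<close> is sought near the coarse part \<open>j\<close> of
      \<open>c - m0\<close>.\<close>
    obtain j f where jf: "f \<in> supp_iter L F n" "c - m0 = ?P n j + f"
      using lattice_decompose[OF rep] by blast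
    obtain m where m: "norm (rvec (m - j)) \<le> R" "occurs_at q (Some \<circ> x) m"
      using R q1 q2 q3 unfolding repetitivity_radius_def norm_rvec_diff by blast
    obtain u where u: "norm u \<le> C" "rvec f = ((*v) ?A ^^ n) u" using C(2)[OF jf(1)] by blast
    have "occurs_at p (Some \<circ> x) (?P n m + m0)"
      unfolding occurs_at_def
    proof
      fix k assume k: "k \<in> dom p"
      then have "J k \<in> dom q" by (simp add: dq)
      then have "(Some \<circ> x) (m + J k) = q (J k)" using m(2) by (simp only: occurs_at_def)
      then have "x (m + J k) = x (J k)" using k by (simp add: q_def)
      from fixed_point_desubstitute[OF cs fp G this, of k]
      have "x (?P n m + (m0 + k)) = x (m0 + k)"
        by (simp only: JG funpow_add_distrib add.assoc)
      then show "(Some \<circ> x) (?P n m + m0 + k) = p k" using m0[OF k] by (simp add: add.assoc)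
    qed
    moreover have "norm (rvec (?P n m + m0 - c)) \<le> opnorm ?A ^ n * (R + C)"
    proof -
      have "c = m0 + (?P n j + f)" by (simp add: jf(2)[symmetric])
      then have "?P n m + m0 - c = ?P n (m - j) - f"
        by (simp add: funpow_diff_distrib)
      then have "rvec (?P n m + m0 - c) = ((*v) ?A ^^ n) (rvec (m - j) - u)"
        by (simp only: rvec_diff rvec_funpow u funpow_diff_distrib)
      then have "norm (rvec (?P n m + m0 - c)) \<le> opnorm ?A ^ n * norm (rvec (m - j) - u)"
        by (simp only: norm_funpow_le)
      moreover have "norm (rvec (m - j) - u) \<le> R + C"
        using m(1) u(1) norm_triangle_ineq4[of "rvec (m - j)" u] by linarith
      moreover have "0 \<le> opnorm ?A ^ n"
        using rep(2) by (simp add: expansion_matrix_def)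
      ultimately show ?thesis by (meson mult_left_mono order_trans)
    qed
    ultimately show "\<exists>m. norm (rvec (m - c)) \<le> opnorm ?A ^ n * (R + C) \<and>
        occurs_at p (Some \<circ> x) m" by blast
  qed
  then show ?thesis unfolding \<mu>_def by blast
qed

lemma exists_power_scale:
  fixes \<mu> \<nu> r :: real
  assumes "0 < \<mu>" "\<mu> < 1" "1 < \<nu>" "1 \<le> r"
  shows "\<exists>n. r * \<mu> ^ n \<le> 1 \<and> \<nu> ^ n \<le> \<nu> * r powr (- (ln \<nu> / ln \<mu>))"
proof -
  \<comment> \<open>This \<open>t\<close> solves \<open>r * \<mu> powr t = 1\<close>, and \<nu> to
    the power \<open>t\<close> is exactly the claimed power of \<open>r\<close>. Rounding
    \<open>t\<close> up to \<open>n\<close> costs at most one factor \<nu>.\<close>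
  define t where "t = ln r / - ln \<mu>"
  define n where "n = nat \<lceil>t\<rceil>"
  have l: "ln \<mu> < 0" using assms by simp
  \<comment> \<open>From \<open>r\<close> \<ge> 1; hence \<open>nat\<close> does not truncate in
    \<open>n\<close>.\<close>
  then have t: "0 \<le> t" using assms(4) by (simp add: t_def divide_nonneg_neg)
  have n: "t \<le> real n" "real n \<le> t + 1" using t unfolding n_def by linarith+
  have "ln r \<le> real n * - ln \<mu>" using n(1) l by (simp add: t_def field_simps)
  then have "exp (ln r + real n * ln \<mu>) \<le> 1" by simp
  then have 1: "r * \<mu> ^ n \<le> 1"
    using assms by (simp add: exp_add exp_of_nat_mult)
  have "\<nu> ^ n = \<nu> powr real n" using assms(3) by (simp add: powr_realpow)
  also have "\<dots> \<le> \<nu> powr (t + 1)" using n(2) assms(3) by simp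
  also have "\<dots> = \<nu> * \<nu> powr t" using assms(3) by (simp add: powr_add)
  also have "\<nu> powr t = r powr (- (ln \<nu> / ln \<mu>))"
    using assms(3,4) by (simp add: powr_def t_def mult.commute)
  finally show ?thesis using 1 by blast
qed

theorem lemma3p2:
  fixes L :: "int ^ 'n ^ 'n"
    and F\<^sub>1 :: "(int ^ 'n) set"
    and \<zeta> :: "'a::finite \<Rightarrow> (int ^ 'n \<rightharpoonup> 'a)"
    and x :: "(int ^ 'n \<Rightarrow> 'a)"
  assumes "constant_shape_substitution L F\<^sub>1 \<zeta>"
    and "folner (supp_iter L F\<^sub>1)"
    and "primitive L F\<^sub>1 \<zeta>"
    and "aperiodic_set (subst_subshift L F\<^sub>1 \<zeta>)"
    and "x \<in> subst_subshift L F\<^sub>1 \<zeta>"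
    and "subst_config L F\<^sub>1 \<zeta> x = x"
  shows "repetitivity x \<in>
           O[at_top](\<lambda>r. r powr (- (ln (opnorm (rmat L)) / ln (opnorm (matrix_inv (rmat L))))))"
proof -
  define \<nu> where "\<nu> = opnorm (rmat L)"
  define \<mu> where "\<mu> = opnorm (matrix_inv (rmat L))"
  have "expansion_matrix L" using assms(1) by (simp add: constant_shape_substitution_def)
  then have e: "0 < \<mu>" "\<mu> < 1" "1 < \<nu>"
    using opnorm_matrix_inv_pos[of "rmat L"] by (auto simp: expansion_matrix_def \<mu>_def \<nu>_def)
  obtain R where R: "\<And>n r. r * \<mu> ^ n \<le> 1 \<Longrightarrow> repetitivity_radius x r (\<nu> ^ n * R)"
    using repetitivity_radius_scale[OF assms(1,3,5,6)] unfolding \<mu>_def \<nu>_def by blast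
  have "norm (repetitivity x r) \<le> (\<nu> * R) * norm (r powr (- (ln \<nu> / ln \<mu>)))" if "1 \<le> r" for r
  proof -
    obtain n where n: "r * \<mu> ^ n \<le> 1" "\<nu> ^ n \<le> \<nu> * r powr (- (ln \<nu> / ln \<mu>))"
      using exists_power_scale[OF e \<open>1 \<le> r\<close>] by blast
    have r0: "0 \<le> r" using that by simp
    note least = repetitivity_least[OF assms(1,3,5,6) r0]
    have "0 \<le> repetitivity x r" by (rule repetitivity_radius_nonneg[OF least(1) r0])
    moreover have "repetitivity x r \<le> \<nu> ^ n * R" by (rule least(2)[OF R[OF n(1)]])
    \<comment> \<open>The sign of \<open>R\<close> is recovered from the fact that no repetitivity
      radius is negative; it allows the bound on \<open>\<nu> ^ n\<close> to be multiplied by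
      \<open>R\<close>.\<close>
    moreover have "0 \<le> \<nu> ^ n * R" by (rule repetitivity_radius_nonneg[OF R[OF n(1)] r0])
    then have "0 \<le> R" using zero_less_power[of \<nu> n] e(3) by (metis less_trans not_le mult_pos_neg zero_less_one)
    then have "\<nu> ^ n * R \<le> (\<nu> * r powr (- (ln \<nu> / ln \<mu>))) * R"
      using n(2) by (intro mult_right_mono)
    ultimately show ?thesis by (simp add: mult_ac)
  qed
  then show ?thesis
    unfolding \<mu>_def[symmetric] \<nu>_def[symmetric]
    by (intro bigoI[of _ "\<nu> * R"]) (use eventually_ge_at_top[of 1] in eventually_elim, blast)
qed

end
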